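(* (1) Let $b,c\in\mathbb{R}$ with $b,c\notin\{0,-1\}$. The zeros of the polynomial ${}_2F_1(-2,b;c;z)$ are all real and simple if and only if one of the following holds: (i) $c<-1$ and $c<b<0$; (ii) $-1<c<0$ and ($b>0$ or $b<c$); (iii) $c>0$ and ($b<0$ or $b>c$). (2) Let $b,c\in\mathbb{R}$ with $b,c\notin\{0,-1,-2\}$. The zeros of the polynomial ${}_2F_1(-3,b;c;z)$ are all real and simple if and only if one of the following holds: (i) $c<-2$ and $1+c<b<-1$; (ii) $-2<c<-1$ and $-1<b<1+c$; (iii) $c>-1$, $c\neq 0$, and ($b<-1$ or $b>c+1$).
   Context: For $n\in\mathbb{N}$ and real $b,c$ with $c\notin\{0,-1,\dots,-n+1\}$, the hypergeometric polynomial is ${}_2F_1(-n,b;c;z)=\sum_{k=0}^{n}\frac{(-n)_k(b)_k}{(c)_k}\frac{z^k}{k!}$, where $(\alpha)_0=1$ and $(\alpha)_k=\alpha(\alpha+1)\cdots(\alpha+k-1)$ for $k\ge1$. The condition $b\notin\{0,-1,\dots,-n+1\}$ ensures that it has degree exactly $n$. "Zeros" means all complex zeros. *)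

theory Defs
  imports Complex_Main "HOL-Computational_Algebra.Computational_Algebra"
begin

text \<open>
  For \<open>c \<in> {0, -1, \<dots>, -n + 1}\<close> some denominators vanish and the value is only an artefact of
  \<open>x / 0 = 0\<close>; such \<open>c\<close> have to be excluded wherever the polynomial is used.
\<close>
definition hypergeometric_poly :: "nat \<Rightarrow> 'a :: field_char_0 \<Rightarrow> 'a \<Rightarrow> 'a poly" where
  "hypergeometric_poly n b c =
     (\<Sum>k\<le>n. monom (pochhammer (- of_nat n) k * pochhammer b k / pochhammer c k / fact k) k)"

lemma coeff_hypergeometric_poly:
  "coeff (hypergeometric_poly n b c) k =
     pochhammer (- of_nat n) k * pochhammer b k / pochhammer c k / fact k"
proof (cases "k \<le> n")
  case True
  then show ?thesis by (simp add: hypergeometric_poly_def coeff_sum)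
next
  case False
  then show ?thesis by (simp add: hypergeometric_poly_def coeff_sum pochhammer_of_nat_eq_0_lemma)
qed

lemma fps_of_hypergeometric_poly:
  "fps_of_poly (hypergeometric_poly n b c) = fps_hypergeo [- of_nat n, b] [c] 1"
  by (rule fps_ext) (simp add: coeff_hypergeometric_poly fps_hypergeo_def)

lemma poly_hypergeometric_poly:
  "poly (hypergeometric_poly n b c) z =
     (\<Sum>k\<le>n. pochhammer (- of_nat n) k * pochhammer b k / pochhammer c k * (z ^ k / fact k))"
  by (simp add: hypergeometric_poly_def poly_sum poly_monom)

definition zeros_real_and_simple :: "complex poly \<Rightarrow> bool" where
  "zeros_real_and_simple p \<longleftrightarrow> (\<forall>z. poly p z = 0 \<longrightarrow> z \<in> \<real> \<and> order z p = 1)"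

end

theory Submission
  imports Defs
begin

text \<open>
  A real quadratic or cubic polynomial has only real and simple zeros iff its discriminant is
  positive. The discriminants of \<open>\<^sub>2F\<^sub>1(-2, b; c; z)\<close> and \<open>\<^sub>2F\<^sub>1(-3, b; c; z)\<close> factor into linear terms
  and equal \<open>b (b - c) (c + 1)\<close> and \<open>(b - c)\<^sup>2 (b + 1) (b - c - 1) (c + 1)\<close> up to positive
  factors; the stated regions are those where these products are positive.
\<close>

text \<open>Since \<open>order\<close> is the multiplicity in \<open>proots\<close>, the condition
  becomes a finite check once the roots are listed.\<close>

lemma zeros_real_and_simple_iff_proots:
  assumes "p \<noteq> 0"
  shows "zeros_real_and_simple p \<longleftrightarrow> (\<forall>z\<in>#proots p. z \<in> \<real> \<and> count (proots p) z = 1)"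
  using assms by (simp add: zeros_real_and_simple_def)

lemma Reals_if_square_pos:
  fixes z :: complex
  assumes "z\<^sup>2 = of_real r" and "r > 0"
  shows "z \<in> \<real>" and "z \<noteq> 0"
proof -
  have "z\<^sup>2 = (of_real (sqrt r))\<^sup>2"
    using assms by (simp flip: of_real_power)
  then show "z \<in> \<real>"
    by (auto simp: power2_eq_iff)
  show "z \<noteq> 0"
    using assms by auto
qed

text \<open>Conjugation acts here as the transposition of \<open>x\<close> and \<open>y\<close>,
  under which the Vandermonde product is alternating.\<close>

lemma cnj_root_differences:
  assumes "cnj x = y" and "cnj z = z"
  shows "cnj ((x - y) * (y - z) * (z - x)) = - ((x - y) * (y - z) * (z - x))"
proof -
  have "cnj y = x"
    using assms(1) by auto
  then show ?thesis
    using assms by (simp add: algebra_simps)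
qed

lemma size_eq_2_msetE:
  assumes "size M = 2"
  obtains x y where "M = {#x, y#}"
proof -
  obtain x N where "M = add_mset x N" "size N = 1"
    using size_eq_Suc_imp_eq_union[of M 1] assms by auto
  then show ?thesis
    using that size_1_singleton_mset by blast
qed

lemma size_eq_3_msetE:
  assumes "size M = 3"
  obtains x y z where "M = {#x, y, z#}"
proof -
  obtain x N where "M = add_mset x N" "size N = 2"
    using size_eq_Suc_imp_eq_union[of M 2] assms by auto
  then show ?thesis
    using that size_eq_2_msetE by metis
qed

text \<open>The discriminant is the square of \<open>a * (x - y)\<close> for the roots
  \<open>x\<close>, \<open>y\<close>. If it is positive, this difference is real and nonzero; the
  sum of the roots is real anyway, so both roots are real.\<close>

lemma zeros_real_and_simple_quadratic:
  fixes a b c :: real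
  assumes "a \<noteq> 0"
  shows "zeros_real_and_simple [:of_real c, of_real b, of_real a:] \<longleftrightarrow> b\<^sup>2 - 4 * a * c > 0"
proof -
  define p where "p = [:complex_of_real c, of_real b, of_real a:]"
  have deg: "degree p = 2" "lead_coeff p = of_real a" and "p \<noteq> 0"
    using assms by (simp_all add: p_def)
  then obtain x y where roots: "proots p = {#x, y#}"
    using size_proots_complex[of p] by (metis size_eq_2_msetE)
  have p: "p = smult (of_real a) ([:- x, 1:] * [:- y, 1:])"
    using complex_poly_decompose_multiset[of p, unfolded deg(2) roots]
    by (simp del: mult_pCons_left mult_pCons_right smult_pCons)
  have coeffs: "complex_of_real b = - of_real a * (x + y)" "complex_of_real c = of_real a * x * y"
    using p unfolding p_def by (simp_all add: algebra_simps)
  have disc: "(of_real a * (x - y))\<^sup>2 = complex_of_real (b\<^sup>2 - 4 * a * c)"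
    unfolding of_real_diff of_real_mult of_real_power coeffs
    by (simp add: power2_eq_square algebra_simps)
  have "zeros_real_and_simple p \<longleftrightarrow> x \<in> \<real> \<and> y \<in> \<real> \<and> x \<noteq> y"
    unfolding zeros_real_and_simple_iff_proots[OF \<open>p \<noteq> 0\<close>] by (auto simp: roots)
  also have "\<dots> \<longleftrightarrow> b\<^sup>2 - 4 * a * c > 0"
  proof
    assume *: "x \<in> \<real> \<and> y \<in> \<real> \<and> x \<noteq> y"
    then obtain r s where rs: "x = of_real r" "y = of_real s" by (auto elim!: Reals_cases)
    have "complex_of_real ((a * (r - s))\<^sup>2) = of_real (b\<^sup>2 - 4 * a * c)"
      unfolding disc[symmetric] rs by simp
    then have "(a * (r - s))\<^sup>2 = b\<^sup>2 - 4 * a * c"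
      by (simp only: of_real_eq_iff)
    then show "b\<^sup>2 - 4 * a * c > 0"
      using * rs assms by (metis eq_iff_diff_eq_0 mult_eq_0_iff zero_less_power2)
  next
    assume pos: "b\<^sup>2 - 4 * a * c > 0"
    define D S where "D = of_real a * (x - y)" and "S = of_real a * (x + y)"
    have D: "D \<in> \<real>" "D \<noteq> 0"
      using Reals_if_square_pos[OF disc pos] by (simp_all add: D_def)
    have S: "S \<in> \<real>"
      using coeffs(1) unfolding S_def by (metis Reals_minus_iff Reals_of_real mult_minus_left)
    have "x * of_real (2 * a) = S + D" "y * of_real (2 * a) = S - D"
      by (simp_all add: S_def D_def algebra_simps)
    moreover have "complex_of_real (2 * a) \<noteq> 0"
      using assms by simp
    ultimately have "x = (S + D) / of_real (2 * a)" "y = (S - D) / of_real (2 * a)"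
      by (metis nonzero_eq_divide_eq)+
    then have "x \<in> \<real>" "y \<in> \<real>"
      using S D(1) by (metis Reals_add Reals_diff Reals_divide Reals_of_real)+
    moreover have "x \<noteq> y"
      using D(2) by (auto simp: D_def)
    ultimately show "x \<in> \<real> \<and> y \<in> \<real> \<and> x \<noteq> y"
      by simp
  qed
  finally show ?thesis unfolding p_def .
qed

lemma zeros_real_and_simple_cubic:
  fixes a b c d :: real
  assumes "a \<noteq> 0"
  shows "zeros_real_and_simple [:of_real d, of_real c, of_real b, of_real a:] \<longleftrightarrow>
    b\<^sup>2 * c\<^sup>2 - 4 * a * c^3 - 4 * b^3 * d - 27 * a\<^sup>2 * d\<^sup>2 + 18 * a * b * c * d > 0"
    (is "_ \<longleftrightarrow> ?disc > 0")
proof -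
  define p where "p = [:complex_of_real d, of_real c, of_real b, of_real a:]"
  have deg: "degree p = 3" "lead_coeff p = of_real a" and "p \<noteq> 0"
    using assms by (simp_all add: p_def)
  then obtain x y z where roots: "proots p = {#x, y, z#}"
    using size_proots_complex[of p] by (metis size_eq_3_msetE)
  have p: "p = smult (of_real a) ([:- x, 1:] * [:- y, 1:] * [:- z, 1:])"
    using complex_poly_decompose_multiset[of p, unfolded deg(2) roots]
    by (simp add: mult.assoc del: mult_pCons_left mult_pCons_right smult_pCons)
  have coeffs: "complex_of_real b = - of_real a * (x + y + z)"
    "complex_of_real c = of_real a * (x * y + y * z + z * x)"
    "complex_of_real d = - of_real a * x * y * z"
    using p unfolding p_def by (simp_all add: algebra_simps)
  \<comment> \<open>The factor \<open>a\<^sup>2\<close> makes the square of \<open>D\<close> exactly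
    the discriminant.\<close>
  define D where "D = (of_real a)\<^sup>2 * (x - y) * (y - z) * (z - x)"
  have disc: "D\<^sup>2 = complex_of_real ?disc"
    unfolding of_real_diff of_real_add of_real_mult of_real_power coeffs D_def of_real_numeral
    by (simp only: power2_eq_square power3_eq_cube) algebra
  \<comment> \<open>As \<open>a\<close> is nonzero, \<open>D \<noteq> 0\<close> says that the three
    roots are pairwise distinct.\<close>
  have "zeros_real_and_simple p \<longleftrightarrow> x \<in> \<real> \<and> y \<in> \<real> \<and> z \<in> \<real> \<and> D \<noteq> 0"
    unfolding zeros_real_and_simple_iff_proots[OF \<open>p \<noteq> 0\<close>]
    using assms by (auto simp: roots D_def)
  also have "\<dots> \<longleftrightarrow> ?disc > 0"
  proof
    assume *: "x \<in> \<real> \<and> y \<in> \<real> \<and> z \<in> \<real> \<and> D \<noteq> 0"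
    then have "D \<in> \<real>"
      by (simp add: D_def)
    then obtain r where r: "D = of_real r" by (auto elim!: Reals_cases)
    have "complex_of_real (r\<^sup>2) = of_real ?disc"
      unfolding disc[symmetric] r by simp
    then have "r\<^sup>2 = ?disc"
      by (simp only: of_real_eq_iff)
    then show "?disc > 0"
      using * r by (metis of_real_0 zero_less_power2)
  next
    assume pos: "?disc > 0"
    have D: "D \<in> \<real>" "D \<noteq> 0"
      using Reals_if_square_pos[OF disc pos] by simp_all
    have root_iff: "poly p w = 0 \<longleftrightarrow> w = x \<or> w = y \<or> w = z" for w
      using set_count_proots[OF \<open>p \<noteq> 0\<close>] roots by auto
    \<comment> \<open>The coefficients are real, so conjugation maps roots to roots.\<close>
    have "poly p (cnj w) = 0" if "poly p w = 0" for w
      using that poly_cnj_real[of p w] by (auto simp: p_def coeff_pCons split: nat.splits)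
    then have "cnj w = x \<or> cnj w = y \<or> cnj w = z" if "w = x \<or> w = y \<or> w = z" for w
      using that root_iff by blast
    then have closed: "cnj x \<in> {x, y, z}" "cnj y \<in> {x, y, z}" "cnj z \<in> {x, y, z}"
      by auto
    have distinct: "x \<noteq> y" "y \<noteq> z" "z \<noteq> x"
      using D by (auto simp: D_def)
    \<comment> \<open>The product is cyclically symmetric, so \<open>cnj_root_differences\<close>
      applies to each of the three transpositions.\<close>
    have D_alts: "D = (of_real a)\<^sup>2 * ((x - y) * (y - z) * (z - x))"
      "D = (of_real a)\<^sup>2 * ((y - z) * (z - x) * (x - y))"
      "D = (of_real a)\<^sup>2 * ((z - x) * (x - y) * (y - z))"
      by (simp_all add: D_def mult_ac)
    have cnj_D: "cnj D = - D" if "cnj w = - w" "D = (of_real a)\<^sup>2 * w" for w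
      using that by simp
    have "cnj D \<noteq> - D"
      using D by (simp add: Reals_cnj_iff)
    \<comment> \<open>A conjugation that moves a root swaps two of them and fixes the third, which would make
      \<open>D\<close> imaginary.\<close>
    have anti: "\<not> (cnj x = y \<and> cnj z = z)" "\<not> (cnj y = z \<and> cnj x = x)"
      "\<not> (cnj z = x \<and> cnj y = y)"
      using \<open>cnj D \<noteq> - D\<close> cnj_D[OF _ D_alts(1)] cnj_D[OF _ D_alts(2)]
        cnj_D[OF _ D_alts(3)] cnj_root_differences[of x y z]
        cnj_root_differences[of y z x] cnj_root_differences[of z x y]
      by blast+
    have cnj_commute: "cnj u = v \<longleftrightarrow> cnj v = u" for u v :: complex by auto
    show "x \<in> \<real> \<and> y \<in> \<real> \<and> z \<in> \<real> \<and> D \<noteq> 0"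
      \<comment> \<open>An involution of three distinct roots is the identity or swaps two and fixes
        the third; \<open>anti\<close> leaves only the identity.\<close>
      using closed distinct anti D(2) cnj_commute unfolding Reals_cnj_iff
      by force
  qed
  finally show ?thesis unfolding p_def .
qed

text \<open>The constant term is written \<open>of_real 1\<close> to match the form of the quadratic
  criterion.\<close>

lemma hypergeometric_poly_2:
  fixes b c :: real
  shows "hypergeometric_poly 2 (complex_of_real b) (of_real c) =
    [:of_real 1, of_real (- 2 * b / c), of_real (b * (b + 1) / (c * (c + 1))):]"
  unfolding hypergeometric_poly_def
  by (simp add: numeral_2_eq_2 monom_0 monom_Suc pochhammer_Suc fact_numeral eval_nat_numeral)

lemma hypergeometric_poly_3:
  fixes b c :: real
  shows "hypergeometric_poly 3 (complex_of_real b) (of_real c) =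
    [:of_real 1, of_real (- 3 * b / c), of_real (3 * b * (b + 1) / (c * (c + 1))),
      of_real (- b * (b + 1) * (b + 2) / (c * (c + 1) * (c + 2))):]"
  unfolding hypergeometric_poly_def
  by (simp add: monom_0 monom_Suc pochhammer_Suc fact_numeral eval_nat_numeral)

text \<open>The left side is the instance of the quadratic criterion. Expanding by
  \<open>c + 1\<close> turns the denominator into a square, so the sign is that of a
  polynomial.\<close>

lemma discriminant_hypergeometric_poly_2:
  fixes b c :: real
  assumes "c \<notin> {0, -1}"
  shows "(- 2 * b / c)\<^sup>2 - 4 * (b * (b + 1) / (c * (c + 1))) * 1 =
    (2 / (c * (c + 1)))\<^sup>2 * (b * (b - c) * (c + 1))"
proof -
  have "c \<noteq> 0" "c + 1 \<noteq> 0" using assms by auto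
  then show ?thesis
    by (simp add: divide_simps) algebra
qed

text \<open>As in degree 2, a square is split off. It vanishes for \<open>b = c\<close>, where the
  polynomial is the cube of \<open>1 - z\<close>.\<close>

lemma discriminant_hypergeometric_poly_3:
  fixes b c :: real
  assumes "c \<notin> {0, -1, -2}"
  shows "(3 * b * (b + 1) / (c * (c + 1)))\<^sup>2 * (- 3 * b / c)\<^sup>2
      - 4 * (- b * (b + 1) * (b + 2) / (c * (c + 1) * (c + 2))) * (- 3 * b / c)^3
      - 4 * (3 * b * (b + 1) / (c * (c + 1)))^3 * 1
      - 27 * (- b * (b + 1) * (b + 2) / (c * (c + 1) * (c + 2)))\<^sup>2 * 1\<^sup>2
      + 18 * (- b * (b + 1) * (b + 2) / (c * (c + 1) * (c + 2))) *
        (3 * b * (b + 1) / (c * (c + 1))) * (- 3 * b / c) * 1 =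
    3 * (6 * b * (b - c) / (c\<^sup>2 * (c + 1)\<^sup>2 * (c + 2)))\<^sup>2 * ((b + 1) * (b - c - 1) * (c + 1))"
proof -
  have "c \<noteq> 0" "c + 1 \<noteq> 0" "c + 2 \<noteq> 0" using assms by auto
  then show ?thesis
    by (simp add: divide_simps) algebra
qed

theorem proposition4:
  shows "(\<forall>b c :: real. b \<notin> {0, -1} \<longrightarrow> c \<notin> {0, -1} \<longrightarrow>
      (zeros_real_and_simple (hypergeometric_poly 2 (complex_of_real b) (complex_of_real c)) \<longleftrightarrow>
         (c < -1 \<and> c < b \<and> b < 0) \<or>
         (-1 < c \<and> c < 0 \<and> (b > 0 \<or> b < c)) \<or>
         (c > 0 \<and> (b < 0 \<or> b > c))))
    \<and> (\<forall>b c :: real. b \<notin> {0, -1, -2} \<longrightarrow> c \<notin> {0, -1, -2} \<longrightarrow>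
      (zeros_real_and_simple (hypergeometric_poly 3 (complex_of_real b) (complex_of_real c)) \<longleftrightarrow>
         (c < -2 \<and> 1 + c < b \<and> b < -1) \<or>
         (-2 < c \<and> c < -1 \<and> -1 < b \<and> b < 1 + c) \<or>
         (c > -1 \<and> c \<noteq> 0 \<and> (b < -1 \<or> b > c + 1))))"
proof (intro conjI allI impI)
  fix b c :: real
  assume b: "b \<notin> {0, -1}" and c: "c \<notin> {0, -1}"
  \<comment> \<open>The first fact says that the degree is exactly 2, as the criterion
    requires.\<close>
  have nz: "b * (b + 1) / (c * (c + 1)) \<noteq> 0" "(2 / (c * (c + 1)))\<^sup>2 > 0"
    using b c by auto
  show "zeros_real_and_simple (hypergeometric_poly 2 (complex_of_real b) (complex_of_real c)) \<longleftrightarrow>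
         (c < -1 \<and> c < b \<and> b < 0) \<or>
         (-1 < c \<and> c < 0 \<and> (b > 0 \<or> b < c)) \<or>
         (c > 0 \<and> (b < 0 \<or> b > c))"
    unfolding hypergeometric_poly_2 zeros_real_and_simple_quadratic[OF nz(1)]
      discriminant_hypergeometric_poly_2[OF c]
    using nz(2) b c by (auto simp: zero_less_mult_iff mult_less_0_iff)
next
  fix b c :: real
  assume b: "b \<notin> {0, -1, -2}" and c: "c \<notin> {0, -1, -2}"
  have nz: "- b * (b + 1) * (b + 2) / (c * (c + 1) * (c + 2)) \<noteq> 0"
    using b c by auto
  show "zeros_real_and_simple (hypergeometric_poly 3 (complex_of_real b) (complex_of_real c)) \<longleftrightarrow>
         (c < -2 \<and> 1 + c < b \<and> b < -1) \<or>
         (-2 < c \<and> c < -1 \<and> -1 < b \<and> b < 1 + c) \<or>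
         (c > -1 \<and> c \<noteq> 0 \<and> (b < -1 \<or> b > c + 1))"
    unfolding hypergeometric_poly_3 zeros_real_and_simple_cubic[OF nz(1)]
      discriminant_hypergeometric_poly_3[OF c]
    \<comment> \<open>The sign of \<open>c + 1\<close> decides whether \<open>b\<close> lies outside
      or between \<open>-1\<close> and \<open>c + 1\<close>, and these two change order at
      \<open>c = -2\<close>. For \<open>b = c\<close> both sides are false, since the last factor is
      then minus the square of \<open>c + 1\<close>.\<close>
    using b c by (auto simp: zero_less_mult_iff mult_less_0_iff)
qed
end
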